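(* Let $\mathcal{R}=\{1,\dots,n\}$ be a route set with durations $l_i\in\mathbb{R}$, and let $T>0$, $\beta>0$. Let $\boldsymbol{\theta}\in[0,T)^n$ be the optimal timetable produced by the procedure TimeTableLogit, and let $\Delta$ be its characteristic values under logit routing. Then uniform random travelers facing $\boldsymbol{\theta}$ under logit routing choose route $i\in\mathcal{R}$ with probability $\Delta_i/T$; that is, with $t$ uniformly distributed on $[0,T)$, $$\mathbb{E}_t\left(p_i^{logit}(\mathcal{R}_\theta(t))\right)=\frac{\Delta_i}{T}\qquad\forall i\in\mathcal{R}.$$
   Context: For $x\in\mathbb{R}$, $[x]_T$ denotes the element of $[0,T)$ differing from $x$ by an integer multiple of $T$. The observed route set $\mathcal{R}_\theta(t)$ has durations $l_i+[\theta_i-t]_T$, so $p_i^{logit}(\mathcal{R}_\theta(t))=e^{-\beta(l_i+[\theta_i-t]_T)}/\sum_{j\in\mathcal{R}}e^{-\beta(l_j+[\theta_j-t]_T)}$. Procedure TimeTableLogit: let $y$ be an optimal solution of $\min\frac1T\sum_{i\in\mathcal{R}}\left(\frac12y_i^2+l_iy_i+\frac{y_i}{\beta}\log\left(\frac{1-e^{-\beta y_i}}{1-e^{-\beta T}}\right)\right)$ subject to $\sum_{i\in\mathcal{R}}y_i=T$, $y\ge0$ (the logarithmic term is $0$ when $y_i=0$). Set $\hat\Delta_i=y_i$ and $\hat\tau_i=l_i+\frac1\beta\log\left(\frac{1-e^{-\beta\hat\Delta_i}}{1-e^{-\beta T}}\right)$ for all $i$; set $\theta_1=0$ and, for $i=2,\dots,n$,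 $\hat\delta_i=\hat\tau_{i-1}+\hat\Delta_{i-1}-\hat\tau_i$ and $\theta_i=\theta_{i-1}+\hat\delta_i$; return $\boldsymbol{\theta}$. Characteristic values of a timetable $\boldsymbol{\theta}$ under logit routing: order the routes cyclically by departure time, ties by index, with predecessor $\pi(i)$ and successor $\sigma(i)$. Let $w(i,j)=T$ if $\theta_i=\theta_j$ and $j<i$, and $w(i,j)=[\theta_j-\theta_i]_T$ otherwise. If $n=1$, $\delta_1=T$, $\tau_1=l_1$; otherwise $\delta_i=w(\pi(i),i)$ and $\tau_i=-\frac1\beta\log\left(\sum_{j\in\mathcal{R}}e^{-\beta(l_j+w(i,j))}\right)$. In all cases $\Delta_i=\delta_{\sigma(i)}+\tau_{\sigma(i)}-\tau_i$. *)

theory Defs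
  imports "HOL-Probability.Probability" "HOL-Library.Real_Mod"
begin

(* Routes are the indices 1, ..., n.  A vector indexed by routes (durations, departure times,
   headways) is a function on nat of which only the values on {1..n} are used.
   For T > 0, "x rmod T" is the element of [0, T) that differs from x by an integer
   multiple of T. *)

definition p_logit :: "real \<Rightarrow> nat \<Rightarrow> (nat \<Rightarrow> real) \<Rightarrow> nat \<Rightarrow> real" where
  "p_logit \<beta> n d i = exp (- \<beta> * d i) / (\<Sum>j\<in>{1..n}. exp (- \<beta> * d j))"

definition observed_duration ::
    "real \<Rightarrow> (nat \<Rightarrow> real) \<Rightarrow> (nat \<Rightarrow> real) \<Rightarrow> real \<Rightarrow> nat \<Rightarrow> real" where
  "observed_duration T l \<theta> t i = l i + (\<theta> i - t) rmod T"

subsection \<open>The procedure TimeTableLogit\<close>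

definition feasible_headways :: "real \<Rightarrow> nat \<Rightarrow> (nat \<Rightarrow> real) \<Rightarrow> bool" where
  "feasible_headways T n y \<longleftrightarrow> (\<Sum>i\<in>{1..n}. y i) = T \<and> (\<forall>i\<in>{1..n}. 0 \<le> y i)"

definition logit_cost ::
    "real \<Rightarrow> real \<Rightarrow> nat \<Rightarrow> (nat \<Rightarrow> real) \<Rightarrow> (nat \<Rightarrow> real) \<Rightarrow> real" where
  "logit_cost T \<beta> n l y = 1 / T * (\<Sum>i\<in>{1..n}. 1 / 2 * (y i)\<^sup>2 + l i * y i +
     (if y i = 0 then 0
      else y i / \<beta> * ln ((1 - exp (- \<beta> * y i)) / (1 - exp (- \<beta> * T)))))"

definition tau_hat ::
    "real \<Rightarrow> real \<Rightarrow> (nat \<Rightarrow> real) \<Rightarrow> (nat \<Rightarrow> real) \<Rightarrow> nat \<Rightarrow> real" where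
  "tau_hat T \<beta> l y i = l i + 1 / \<beta> * ln ((1 - exp (- \<beta> * y i)) / (1 - exp (- \<beta> * T)))"

definition delta_hat ::
    "real \<Rightarrow> real \<Rightarrow> (nat \<Rightarrow> real) \<Rightarrow> (nat \<Rightarrow> real) \<Rightarrow> nat \<Rightarrow> real" where
  "delta_hat T \<beta> l y i = tau_hat T \<beta> l y (i - 1) + y (i - 1) - tau_hat T \<beta> l y i"

(* The procedure may start from any optimal solution y, hence a relation rather than a
   function. *)
definition time_table_logit ::
    "real \<Rightarrow> real \<Rightarrow> nat \<Rightarrow> (nat \<Rightarrow> real) \<Rightarrow> (nat \<Rightarrow> real) \<Rightarrow> bool" where
  "time_table_logit T \<beta> n l \<theta> \<longleftrightarrow>
     (\<exists>y. is_arg_min (logit_cost T \<beta> n l) (feasible_headways T n) y \<and>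
          \<theta> 1 = 0 \<and> (\<forall>i\<in>{2..n}. \<theta> i = \<theta> (i - 1) + delta_hat T \<beta> l y i))"

subsection \<open>Characteristic values under logit routing\<close>

(* sort_key is stable, so ties in departure time are broken by index. *)
definition departure_order :: "nat \<Rightarrow> (nat \<Rightarrow> real) \<Rightarrow> nat list" where
  "departure_order n \<theta> = sort_key \<theta> [1..<Suc n]"

definition departure_pos :: "nat \<Rightarrow> (nat \<Rightarrow> real) \<Rightarrow> nat \<Rightarrow> nat" where
  "departure_pos n \<theta> i = (THE k. k < n \<and> departure_order n \<theta> ! k = i)"

definition route_succ :: "nat \<Rightarrow> (nat \<Rightarrow> real) \<Rightarrow> nat \<Rightarrow> nat" where
  "route_succ n \<theta> i = departure_order n \<theta> ! ((departure_pos n \<theta> i + 1) mod n)"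

definition route_pred :: "nat \<Rightarrow> (nat \<Rightarrow> real) \<Rightarrow> nat \<Rightarrow> nat" where
  "route_pred n \<theta> i = departure_order n \<theta> ! ((departure_pos n \<theta> i + n - 1) mod n)"

definition wait :: "real \<Rightarrow> (nat \<Rightarrow> real) \<Rightarrow> nat \<Rightarrow> nat \<Rightarrow> real" where
  "wait T \<theta> i j = (if \<theta> i = \<theta> j \<and> j < i then T else (\<theta> j - \<theta> i) rmod T)"

definition char_delta :: "real \<Rightarrow> nat \<Rightarrow> (nat \<Rightarrow> real) \<Rightarrow> nat \<Rightarrow> real" where
  "char_delta T n \<theta> i = (if n = 1 then T else wait T \<theta> (route_pred n \<theta> i) i)"

definition char_tau ::
    "real \<Rightarrow> real \<Rightarrow> nat \<Rightarrow> (nat \<Rightarrow> real) \<Rightarrow> (nat \<Rightarrow> real) \<Rightarrow> nat \<Rightarrow> real" where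
  "char_tau T \<beta> n l \<theta> i =
     (if n = 1 then l i
      else - (1 / \<beta>) * ln (\<Sum>j\<in>{1..n}. exp (- \<beta> * (l j + wait T \<theta> i j))))"

definition char_Delta ::
    "real \<Rightarrow> real \<Rightarrow> nat \<Rightarrow> (nat \<Rightarrow> real) \<Rightarrow> (nat \<Rightarrow> real) \<Rightarrow> nat \<Rightarrow> real" where
  "char_Delta T \<beta> n l \<theta> i =
     char_delta T n \<theta> (route_succ n \<theta> i) + char_tau T \<beta> n l \<theta> (route_succ n \<theta> i)
       - char_tau T \<beta> n l \<theta> i"

end

theory Submission
  imports Defs "HOL-Real_Asymp.Real_Asymp"
begin

text \<open>The proof rests on two telescoping sums. Write \<open>G(y) = y / (1 - exp (- \<beta> y))\<close> and \<open>e(y) = exp (- \<beta> y)\<close>, so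
that \<open>G(y) - y = e(y) G(y)\<close>.

The cost of a single route has derivative \<open>\<tau>\<^sub>i + G(y\<^sub>i)\<close>, where \<open>\<tau>\<^sub>i\<close> is the estimated logit duration of the
procedure, and slope \<open>-\<infinity>\<close> at \<open>0\<close>. Moving a little headway between two routes therefore shows that an
optimal \<open>y\<close> is positive and that \<open>\<tau>\<^sub>i + G(y\<^sub>i)\<close> has the same value \<open>\<mu>\<close> for all routes
(\<open>optimal_headways_pos\<close>, \<open>optimal_headways_stationary\<close>). Everything else follows from these
conditions alone.

Consecutive departures satisfy \<open>\<theta>\<^sub>i\<^sub>+\<^sub>1 - \<theta>\<^sub>i = y\<^sub>i + \<tau>\<^sub>i - \<tau>\<^sub>i\<^sub>+\<^sub>1 = G(y\<^sub>i\<^sub>+\<^sub>1) - e(y\<^sub>i) G(y\<^sub>i)\<close>, also cyclically, with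
\<open>T\<close> as the departure after the last one. Since \<open>e(y) G(y) < 1 / \<beta> < G(y)\<close> for \<open>y > 0\<close>, the gaps are
positive: the routes depart in the order of their indices, without ties, and within one period.

Put \<open>\<sigma>\<^sub>i = \<theta>\<^sub>i + \<tau>\<^sub>i\<close>, so that \<open>\<sigma>\<^sub>i\<^sub>+\<^sub>1 = \<sigma>\<^sub>i + y\<^sub>i\<close>. The definition of \<open>\<tau>\<^sub>i\<close> turns into
\<open>(1 - e(T)) exp (- \<beta> (l\<^sub>i + \<theta>\<^sub>i)) = exp (- \<beta> \<sigma>\<^sub>i) - exp (- \<beta> \<sigma>\<^sub>i\<^sub>+\<^sub>1)\<close>. Summing this over all routes, with a factor
\<open>e(T)\<close> on those that have already departed and are next available one period later, evaluates every
logit denominator as a single exponential (\<open>sum_discounted_weights\<close>). So the procedure's estimates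
are the true characteristic values, \<open>\<Delta>\<^sub>i = y\<^sub>i\<close> (\<open>char_Delta_eq\<close>), and the choice probability of route \<open>i\<close>
is constant between consecutive departures. In its expectation, the gap
\<open>G(y\<^sub>k\<^sub>+\<^sub>1) - e(y\<^sub>k) G(y\<^sub>k)\<close> is multiplied by \<open>exp (\<beta> \<sigma>\<^sub>k\<^sub>+\<^sub>1)\<close>, which makes it the increment of
\<open>G(y\<^sub>k) exp (\<beta> \<sigma>\<^sub>k)\<close>; the sum telescopes to \<open>y\<^sub>i / T\<close> (\<open>choice_sum_telescopes\<close>).\<close>

section \<open>First-order conditions for an optimal vector of headways\<close>

definition route_cost :: "real \<Rightarrow> real \<Rightarrow> real \<Rightarrow> real \<Rightarrow> real" where
  "route_cost T \<beta> c x = 1 / 2 * x\<^sup>2 + c * x +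
     (if x = 0 then 0 else x / \<beta> * ln ((1 - exp (- \<beta> * x)) / (1 - exp (- \<beta> * T))))"

definition stretch :: "real \<Rightarrow> real \<Rightarrow> real" where
  "stretch \<beta> x = x / (1 - exp (- \<beta> * x))"

lemma logit_cost_eq_sum:
  "logit_cost T \<beta> n l y = 1 / T * (\<Sum>i\<in>{1..n}. route_cost T \<beta> (l i) (y i))"
  unfolding logit_cost_def route_cost_def ..

lemma stretch_minus_headway:
  assumes "x > 0" "\<beta> > 0"
  shows "stretch \<beta> x - x = exp (- \<beta> * x) * stretch \<beta> x"
proof -
  have "1 - exp (- \<beta> * x) \<noteq> 0" using assms by simp
  then show ?thesis unfolding stretch_def by (simp add: field_simps)
qed

text \<open>Both this bound and the next one are strict forms of \<open>1 + z \<le> exp z\<close>, at \<open>z = - \<beta> x\<close> and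
\<open>z = \<beta> x\<close>. Together they put \<open>1 / \<beta>\<close> strictly between \<open>stretch \<beta> x - x\<close> and \<open>stretch \<beta> x'\<close> for any
two positive headways, which is why no two departures of the timetable coincide.\<close>

lemma stretch_gt:
  assumes "x > 0" "\<beta> > 0"
  shows "1 / \<beta> < stretch \<beta> x"
proof -
  have "1 + (- \<beta> * x) < exp (- \<beta> * x)"
    using assms exp_minus_greater[of "\<beta> * x"] by simp
  moreover have "exp (- \<beta> * x) < 1" using assms by simp
  ultimately show ?thesis unfolding stretch_def using assms
    by (simp add: divide_less_eq less_divide_eq mult.commute)
qed

lemma stretch_minus_headway_lt:
  assumes "x > 0" "\<beta> > 0"
  shows "stretch \<beta> x - x < 1 / \<beta>"
proof -
  have "\<beta> * x + 1 < exp (\<beta> * x)"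
    using assms exp_minus_greater[of "- (\<beta> * x)"] by simp
  then have "(\<beta> * x + 1) * exp (- \<beta> * x) < exp (\<beta> * x) * exp (- \<beta> * x)"
    by (intro mult_strict_right_mono) auto
  also have "\<dots> = 1" by (simp flip: exp_add)
  finally have "exp (- \<beta> * x) * (\<beta> * x) < 1 - exp (- \<beta> * x)" by (simp add: algebra_simps)
  then have "exp (- \<beta> * x) * stretch \<beta> x < 1 / \<beta>"
    unfolding stretch_def using assms by (simp add: field_simps)
  then show ?thesis using stretch_minus_headway[OF assms] by simp
qed

text \<open>The logarithm contributes \<open>x exp (- \<beta> x) / (1 - exp (- \<beta> x))\<close>, which merges with the derivative \<open>x\<close>
of the quadratic term into \<open>stretch \<beta> x\<close>; the remaining terms are the estimated logit duration.\<close>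

lemma DERIV_route_cost:
  assumes "x > 0" "\<beta> > 0" "T > 0"
  shows "(route_cost T \<beta> c has_real_derivative
    c + 1 / \<beta> * ln ((1 - exp (- \<beta> * x)) / (1 - exp (- \<beta> * T))) + stretch \<beta> x) (at x)"
proof -
  let ?f = "\<lambda>x. 1 / 2 * x\<^sup>2 + c * x
    + x / \<beta> * ln ((1 - exp (- \<beta> * x)) / (1 - exp (- \<beta> * T)))"
  have pos: "0 < 1 - exp (- \<beta> * x)" "0 < 1 - exp (- \<beta> * T)" using assms by simp_all
  have "((\<lambda>x. ln ((1 - exp (- \<beta> * x)) / K)) has_real_derivative
      \<beta> * exp (- \<beta> * x) / (1 - exp (- \<beta> * x))) (at x)" if "K > 0" for K
    using pos that assms
    by (auto intro!: derivative_eq_intros simp: field_simps)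
  note log = this[OF pos(2)]
  have quadratic: "((\<lambda>x. 1 / 2 * x\<^sup>2 + c * x) has_real_derivative x + c) (at x)"
    by (auto intro!: derivative_eq_intros)
  have linear: "((\<lambda>x. x / \<beta>) has_real_derivative 1 / \<beta>) (at x)"
    using assms by (auto intro!: derivative_eq_intros)
  have "(?f has_real_derivative x + c
      + 1 / \<beta> * ln ((1 - exp (- \<beta> * x)) / (1 - exp (- \<beta> * T)))
      + exp (- \<beta> * x) * stretch \<beta> x) (at x)"
    using DERIV_add[OF quadratic DERIV_mult[OF linear log]] by (rule DERIV_cong)
      (use assms in \<open>simp add: stretch_def\<close>)
  moreover have "x + exp (- \<beta> * x) * stretch \<beta> x = stretch \<beta> x"
    using stretch_minus_headway[OF assms(1,2)] by simp
  ultimately have "(?f has_real_derivative c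
      + 1 / \<beta> * ln ((1 - exp (- \<beta> * x)) / (1 - exp (- \<beta> * T))) + stretch \<beta> x) (at x)"
    by (elim DERIV_cong) linarith
  then show ?thesis
    by (rule has_field_derivative_transform_within_open[where S = "{0<..}"])
      (use assms in \<open>auto simp: route_cost_def\<close>)
qed

text \<open>The difference quotient is the average cost \<open>s / 2 + c + ln (...) / \<beta>\<close>, whose logarithm diverges:
a route with headway zero always gains from a little headway.\<close>

lemma route_cost_slope_at_0:
  assumes "\<beta> > 0" "T > 0"
  shows "filterlim (\<lambda>s. (route_cost T \<beta> c s - route_cost T \<beta> c 0) / s) at_bot (at_right 0)"
proof -
  have "0 < 1 - exp (- \<beta> * T)" using assms by simp
  moreover define K where "K = 1 - exp (- \<beta> * T)"
  ultimately have K: "K > 0" by simp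
  have lim: "filterlim (\<lambda>s. s / 2 + c + 1 / \<beta> * ln ((1 - exp (- \<beta> * s)) / K)) at_bot (at_right 0)"
    using assms K by real_asymp
  have "\<forall>\<^sub>F s in at_right 0. s / 2 + c + 1 / \<beta> * ln ((1 - exp (- \<beta> * s)) / K)
      = (route_cost T \<beta> c s - route_cost T \<beta> c 0) / s"
    using eventually_at_right_less[of "0::real"]
    by eventually_elim (simp add: route_cost_def K_def field_simps power2_eq_square)
  from iffD1[OF filterlim_cong[OF refl refl this] lim] show ?thesis .
qed

text \<open>Moving headway from one route to another keeps the total, and the cost is a sum over routes, so
optimality of the whole vector reduces to a comparison of two summands.\<close>

lemma exchange_not_profitable:
  assumes min: "is_arg_min (logit_cost T \<beta> n l) (feasible_headways T n) y" and "T > 0"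
    and ij: "i \<in> {1..n}" "j \<in> {1..n}" "i \<noteq> j" and s: "0 \<le> y i + s" "0 \<le> y j - s"
  shows "route_cost T \<beta> (l i) (y i) + route_cost T \<beta> (l j) (y j)
    \<le> route_cost T \<beta> (l i) (y i + s) + route_cost T \<beta> (l j) (y j - s)"
proof -
  define z where "z = y(i := y i + s, j := y j - s)"
  have split: "(\<Sum>k\<in>{1..n}. f k) = f i + f j + (\<Sum>k\<in>{1..n} - {i, j}. f k)" for f :: "nat \<Rightarrow> real"
  proof -
    have "(\<Sum>k\<in>{1..n}. f k) = (\<Sum>k\<in>{i, j}. f k) + (\<Sum>k\<in>{1..n} - {i, j}. f k)"
      using ij by (subst add.commute, intro sum.subset_diff) auto
    then show ?thesis using ij by simp
  qed
  have feas: "feasible_headways T n y"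
    and opt: "\<And>z. feasible_headways T n z \<Longrightarrow> logit_cost T \<beta> n l y \<le> logit_cost T \<beta> n l z"
    using min by (auto simp: is_arg_min_linorder)
  have rest: "(\<Sum>k\<in>{1..n} - {i, j}. g k (z k)) = (\<Sum>k\<in>{1..n} - {i, j}. g k (y k))"
    for g :: "nat \<Rightarrow> real \<Rightarrow> real"
    by (rule sum.cong) (auto simp: z_def)
  have "(\<Sum>k\<in>{1..n}. z k) = T"
    using feas split[of z] split[of y] rest[of "\<lambda>_ x. x"] ij
    by (auto simp: feasible_headways_def z_def)
  moreover have "\<forall>k\<in>{1..n}. 0 \<le> z k" using feas s by (auto simp: feasible_headways_def z_def)
  ultimately have "logit_cost T \<beta> n l y \<le> logit_cost T \<beta> n l z"
    by (intro opt) (simp add: feasible_headways_def)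
  then have "(\<Sum>k\<in>{1..n}. route_cost T \<beta> (l k) (y k)) \<le> (\<Sum>k\<in>{1..n}. route_cost T \<beta> (l k) (z k))"
    using \<open>T > 0\<close> by (simp add: logit_cost_eq_sum divide_le_cancel)
  then have "route_cost T \<beta> (l i) (y i) + route_cost T \<beta> (l j) (y j)
    \<le> route_cost T \<beta> (l i) (z i) + route_cost T \<beta> (l j) (z j)"
    using rest[of "\<lambda>k x. route_cost T \<beta> (l k) x"] by (simp only: split)
  then show ?thesis using ij by (simp add: z_def)
qed

text \<open>If \<open>y\<^sub>i = 0\<close>, some other \<open>y\<^sub>j\<close> is positive. Moving headway \<open>s\<close> from \<open>j\<close> to \<open>i\<close> costs at most a finite
slope at \<open>j\<close> while the slope at \<open>i\<close> is \<open>-\<infinity>\<close>, so for small \<open>s\<close> the move lowers the cost.\<close>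

lemma optimal_headways_pos:
  assumes min: "is_arg_min (logit_cost T \<beta> n l) (feasible_headways T n) y"
    and "T > 0" "\<beta> > 0" and i: "i \<in> {1..n}"
  shows "y i > 0"
proof (rule ccontr)
  assume "\<not> y i > 0"
  moreover have feas: "(\<Sum>k\<in>{1..n}. y k) = T" "\<And>k. k \<in> {1..n} \<Longrightarrow> 0 \<le> y k"
    using min by (auto simp: is_arg_min_linorder feasible_headways_def)
  ultimately have yi: "y i = 0" using i by (simp add: order_antisym)
  obtain j where j: "j \<in> {1..n}" "y j > 0"
    using feas \<open>T > 0\<close> by (metis sum_nonpos not_less)
  with yi have "i \<noteq> j" by auto
  let ?fi = "route_cost T \<beta> (l i)" and ?fj = "route_cost T \<beta> (l j)"
  define D where "D = l j + 1 / \<beta> * ln ((1 - exp (- \<beta> * y j)) / (1 - exp (- \<beta> * T))) + stretch \<beta> (y j)"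
  have "(?fj has_real_derivative D) (at (y j - 0))"
    using DERIV_route_cost[OF j(2) \<open>\<beta> > 0\<close> \<open>T > 0\<close>] by (simp add: D_def)
  then have "((\<lambda>s. ?fj (y j - s)) has_real_derivative D * (0 - 1)) (at 0)"
    by (rule DERIV_chain2) (auto intro!: derivative_eq_intros)
  then have "(\<lambda>s. (?fj (y j - s) - ?fj (y j)) / s) \<midarrow>0\<rightarrow> - D"
    by (simp add: DERIV_def)
  then have "((\<lambda>s. (?fj (y j - s) - ?fj (y j)) / s) \<longlongrightarrow> - D) (at_right 0)"
    by (rule filterlim_mono[OF _ order_refl at_le]) simp
  then have "filterlim (\<lambda>s. (?fj (y j - s) - ?fj (y j)) / s + (?fi s - ?fi 0) / s) at_bot (at_right 0)"
    using route_cost_slope_at_0[OF \<open>\<beta> > 0\<close> \<open>T > 0\<close>]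
    by (simp add: filterlim_tendsto_add_at_bot_iff)
  then have "\<forall>\<^sub>F s in at_right 0. (?fj (y j - s) - ?fj (y j)) / s + (?fi s - ?fi 0) / s < 0"
    by (simp add: filterlim_at_bot_dense)
  moreover have "\<forall>\<^sub>F s in at_right 0. s < y j"
    using j(2) eventually_at_right_field by blast
  moreover note eventually_at_right_less[of "0::real"]
  ultimately have "\<forall>\<^sub>F s in at_right (0::real). False"
  proof eventually_elim
    case (elim s)
    have "?fi 0 + ?fj (y j) \<le> ?fi s + ?fj (y j - s)"
      using exchange_not_profitable[OF min \<open>T > 0\<close> i j(1) \<open>i \<noteq> j\<close>, of s] elim yi by simp
    then have "0 \<le> ((?fj (y j - s) - ?fj (y j)) + (?fi s - ?fi 0)) / s" using elim by simp
    then show False using elim by (simp add: add_divide_distrib)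
  qed
  then show False by simp
qed

text \<open>As both headways are positive, headway can be moved in either direction; the cost of the exchange
has a local minimum at \<open>0\<close>, and its derivative there is the difference of the two sides.\<close>

lemma optimal_headways_stationary:
  assumes min: "is_arg_min (logit_cost T \<beta> n l) (feasible_headways T n) y"
    and "T > 0" "\<beta> > 0" and i: "i \<in> {1..n}" and j: "j \<in> {1..n}"
  shows "tau_hat T \<beta> l y i + stretch \<beta> (y i) = tau_hat T \<beta> l y j + stretch \<beta> (y j)"
proof (cases "i = j")
  case False
  have pos: "y i > 0" "y j > 0" using optimal_headways_pos[OF min] assms by auto
  let ?f = "\<lambda>s. route_cost T \<beta> (l i) (y i + s) + route_cost T \<beta> (l j) (y j - s)"
  have route: "(route_cost T \<beta> (l k) has_real_derivative tau_hat T \<beta> l y k + stretch \<beta> (y k)) (at (y k))"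
    if "y k > 0" for k
    using DERIV_route_cost[OF that \<open>\<beta> > 0\<close> \<open>T > 0\<close>] by (simp add: tau_hat_def)
  have "((\<lambda>s. route_cost T \<beta> (l i) (y i + s)) has_real_derivative
      (tau_hat T \<beta> l y i + stretch \<beta> (y i)) * (0 + 1)) (at 0)"
    by (rule DERIV_chain2) (auto intro!: derivative_eq_intros route pos)
  moreover have "((\<lambda>s. route_cost T \<beta> (l j) (y j - s)) has_real_derivative
      (tau_hat T \<beta> l y j + stretch \<beta> (y j)) * (0 - 1)) (at 0)"
    by (rule DERIV_chain2) (auto intro!: derivative_eq_intros route pos)
  ultimately have "(?f has_real_derivative (tau_hat T \<beta> l y i + stretch \<beta> (y i)) * (0 + 1)
      + (tau_hat T \<beta> l y j + stretch \<beta> (y j)) * (0 - 1)) (at 0)"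
    by (rule DERIV_add)
  moreover have "\<forall>s. \<bar>0 - s\<bar> < min (y i) (y j) \<longrightarrow> ?f 0 \<le> ?f s"
    using exchange_not_profitable[OF min \<open>T > 0\<close> i j False] by auto
  moreover have "0 < min (y i) (y j)" using pos by simp
  ultimately have "(tau_hat T \<beta> l y i + stretch \<beta> (y i)) * (0 + 1)
      + (tau_hat T \<beta> l y j + stretch \<beta> (y j)) * (0 - 1) = 0"
    by (elim DERIV_local_min)
  then show ?thesis by simp
qed simp

section \<open>Integrals of step functions\<close>

text \<open>The order of the end points is part of the claim because the induction step joins two adjacent
intervals. Half-open pieces make this join hold pointwise: they overlap nowhere and leave no gap.\<close>

lemma has_bochner_integral_step_function:
  fixes \<theta> c :: "nat \<Rightarrow> real" and f :: "real \<Rightarrow> real"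
  assumes "\<And>k. k \<in> {a..<b} \<Longrightarrow> \<theta> k \<le> \<theta> (Suc k)"
    and "\<And>k t. \<lbrakk>k \<in> {a..<b}; t \<in> {\<theta> k<..\<theta> (Suc k)}\<rbrakk> \<Longrightarrow> f t = c k"
    and "a \<le> b"
  shows "\<theta> a \<le> \<theta> b \<and> has_bochner_integral lborel (\<lambda>t. indicator {\<theta> a<..\<theta> b} t * f t)
    (\<Sum>k\<in>{a..<b}. (\<theta> (Suc k) - \<theta> k) * c k)"
  using \<open>a \<le> b\<close> assms(1,2)
proof (induction rule: dec_induct)
  case base
  then show ?case by (simp add: has_bochner_integral_zero)
next
  case (step m)
  have IH: "\<theta> a \<le> \<theta> m" "has_bochner_integral lborel (\<lambda>t. indicator {\<theta> a<..\<theta> m} t * f t)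
    (\<Sum>k\<in>{a..<m}. (\<theta> (Suc k) - \<theta> k) * c k)"
    using step by auto
  have le: "\<theta> m \<le> \<theta> (Suc m)" using step by simp
  have "has_bochner_integral lborel (\<lambda>t. indicator {\<theta> m<..\<theta> (Suc m)} t * c m)
      (measure lborel {\<theta> m<..\<theta> (Suc m)} * c m)"
    by (intro has_bochner_integral_mult_left has_bochner_integral_real_indicator) (auto simp: le)
  from has_bochner_integral_add[OF IH(2) this]
  have "has_bochner_integral lborel
      (\<lambda>t. indicator {\<theta> a<..\<theta> m} t * f t + indicator {\<theta> m<..\<theta> (Suc m)} t * c m)
      (\<Sum>k\<in>{a..<Suc m}. (\<theta> (Suc k) - \<theta> k) * c k)"
    using step le by simp
  moreover have "(\<lambda>t. indicator {\<theta> a<..\<theta> m} t * f t + indicator {\<theta> m<..\<theta> (Suc m)} t * c m)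
      = (\<lambda>t. indicator {\<theta> a<..\<theta> (Suc m)} t * f t)"
  proof
    fix t
    have "f t = c m" if "t \<in> {\<theta> m<..\<theta> (Suc m)}" using step that by simp
    then show "indicator {\<theta> a<..\<theta> m} t * f t + indicator {\<theta> m<..\<theta> (Suc m)} t * c m
      = indicator {\<theta> a<..\<theta> (Suc m)} t * f t"
      using IH(1) le by (auto simp: indicator_def)
  qed
  ultimately show ?case using IH(1) le by simp
qed

text \<open>The interval is turned from left-closed to right-closed, to match the pieces between departures: a
traveler who arrives exactly at a departure still catches it.\<close>

lemma integral_uniform_measure_interval:
  fixes f :: "real \<Rightarrow> real"
  assumes [measurable]: "f \<in> borel_measurable borel" and "T > 0"
  shows "(\<integral>t. f t \<partial>uniform_measure lborel {0..<T})
    = (\<integral>t. indicator {0<..T} t * f t \<partial>lborel) / T"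
proof -
  have "uniform_measure lborel {0..<T} = density lborel (\<lambda>t. ennreal (indicator {0..<T} t / T))"
    unfolding uniform_measure_def using \<open>T > 0\<close>
    by (intro density_cong) (auto simp: indicator_def divide_ennreal ennreal_1[symmetric] simp del: ennreal_1)
  then have "(\<integral>t. f t \<partial>uniform_measure lborel {0..<T}) = (\<integral>t. indicator {0..<T} t / T * f t \<partial>lborel)"
    using \<open>T > 0\<close> by (simp add: integral_density)
  also have "\<dots> = (\<integral>t. indicator {0<..T} t * f t / T \<partial>lborel)"
  proof (rule integral_cong_AE)
    have "AE t in lborel. t \<noteq> 0 \<and> t \<noteq> T"
      by (intro AE_conjI AE_lborel_singleton)
    then show "AE t in lborel. indicator {0..<T} t / T * f t = indicator {0<..T} t * f t / T"
      by eventually_elim (auto simp: indicator_def)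
  qed measurable
  also have "\<dots> = (\<integral>t. indicator {0<..T} t * f t \<partial>lborel) / T" by simp
  finally show ?thesis .
qed

section \<open>Timetables built from stationary headways\<close>

text \<open>The positivity and the stationarity of \<open>y\<close> stand in for its optimality; \<open>\<mu>\<close> is the common
derivative of the route costs, the multiplier of the constraint on the total headway up to the
factor \<open>1 / T\<close> of the objective.\<close>

locale stationary_timetable =
  fixes T \<beta> :: real and n :: nat and l \<theta> y :: "nat \<Rightarrow> real" and \<mu> :: real
  assumes T_pos: "T > 0" and beta_pos: "\<beta> > 0" and n_pos: "n \<ge> 1"
    and sum_y: "(\<Sum>i\<in>{1..n}. y i) = T"
    and y_pos: "i \<in> {1..n} \<Longrightarrow> y i > 0"
    and stationary: "i \<in> {1..n} \<Longrightarrow> tau_hat T \<beta> l y i + stretch \<beta> (y i) = \<mu>"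
    and theta_1: "\<theta> 1 = 0"
    and theta_step: "i \<in> {2..n} \<Longrightarrow> \<theta> i = \<theta> (i - 1) + delta_hat T \<beta> l y i"
begin

abbreviation \<tau> :: "nat \<Rightarrow> real" where "\<tau> \<equiv> tau_hat T \<beta> l y"

text \<open>The sequence of departures is closed up by the start \<open>T\<close> of the next period, when route 1 departs
again; \<open>cyc_stretch\<close> below continues in the same way with route 1 after route \<open>n\<close>.\<close>

definition dep :: "nat \<Rightarrow> real" where "dep k = (if k \<le> n then \<theta> k else T)"

text \<open>Departure time plus estimated logit duration, that is, the perceived arrival time of a traveler who
starts at the \<open>k\<close>-th departure (see \<open>arr_eq\<close>). Defining it as a partial sum of headways extends it
to \<open>k = n + 1\<close>, where it must exceed its value at 1 by exactly one period (\<open>arr_Suc_n\<close>).\<close>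

definition arr :: "nat \<Rightarrow> real" where "arr k = \<tau> 1 + (\<Sum>j\<in>{1..<k}. y j)"

definition cyc_stretch :: "nat \<Rightarrow> real" where "cyc_stretch k = stretch \<beta> (y (if k \<le> n then k else 1))"

lemma arr_Suc: "k \<ge> 1 \<Longrightarrow> arr (Suc k) = arr k + y k"
  by (simp add: arr_def)

lemma arr_Suc_n: "arr (Suc n) = arr 1 + T"
  using sum_y by (simp add: arr_def atLeastLessThanSuc_atLeastAtMost)

text \<open>This is the recursion of the procedure, rearranged: \<open>\<theta>\<^sub>i - \<theta>\<^sub>i\<^sub>-\<^sub>1 = \<tau>\<^sub>i\<^sub>-\<^sub>1 + y\<^sub>i\<^sub>-\<^sub>1 - \<tau>\<^sub>i\<close>.\<close>

lemma arr_eq: "i \<in> {1..n} \<Longrightarrow> arr i = \<theta> i + \<tau> i"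
proof (induction i)
  case (Suc i)
  show ?case
  proof (cases "i = 0")
    case True
    then show ?thesis using theta_1 by (simp add: arr_def)
  next
    case False
    then have "\<theta> (Suc i) = \<theta> i + delta_hat T \<beta> l y (Suc i)" "arr i = \<theta> i + \<tau> i"
      using theta_step[of "Suc i"] Suc by auto
    then show ?thesis using False arr_Suc[of i] by (simp add: delta_hat_def)
  qed
qed simp

text \<open>Stationarity replaces the estimated duration by \<open>\<mu>\<close> minus the stretch. The case \<open>k = n + 1\<close> is
where the choice \<open>\<theta>\<^sub>1 = 0\<close> and the total headway \<open>T\<close> close the cycle.\<close>

lemma dep_eq: "k \<in> {1..Suc n} \<Longrightarrow> dep k = arr k + cyc_stretch k - \<mu>"
  using arr_eq[of k] arr_eq[of 1] arr_Suc_n stationary[of k] stationary[of 1] theta_1 n_pos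
  by (cases "k = Suc n") (auto simp: dep_def cyc_stretch_def)

lemma dep_gap:
  assumes "k \<in> {1..n}"
  shows "dep (Suc k) - dep k = cyc_stretch (Suc k) - exp (- \<beta> * y k) * cyc_stretch k"
  using dep_eq[of k] dep_eq[of "Suc k"] arr_Suc[of k] assms
    stretch_minus_headway[OF y_pos[OF assms] beta_pos]
  by (simp add: cyc_stretch_def)

lemma dep_less_Suc:
  assumes "k \<in> {1..n}"
  shows "dep k < dep (Suc k)"
proof -
  have "cyc_stretch k - y k < 1 / \<beta>"
    using stretch_minus_headway_lt[OF y_pos[OF assms] beta_pos] assms by (simp add: cyc_stretch_def)
  moreover have "1 / \<beta> < cyc_stretch (Suc k)"
    unfolding cyc_stretch_def by (rule stretch_gt[OF y_pos beta_pos]) (use assms in auto)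
  ultimately show ?thesis
    using dep_eq[of k] dep_eq[of "Suc k"] arr_Suc[of k] assms by auto
qed

lemma dep_strict_mono: "\<lbrakk>i \<in> {1..Suc n}; j \<in> {1..Suc n}; i < j\<rbrakk> \<Longrightarrow> dep i < dep j"
proof (induction j)
  case (Suc j)
  then show ?case using dep_less_Suc[of j] by (cases "i = j") auto
qed simp

lemma theta_strict_mono: "\<lbrakk>i \<in> {1..n}; j \<in> {1..n}; i < j\<rbrakk> \<Longrightarrow> \<theta> i < \<theta> j"
  using dep_strict_mono[of i j] by (simp add: dep_def)

lemma theta_range: "i \<in> {1..n} \<Longrightarrow> \<theta> i \<in> {0..<T}"
  using dep_strict_mono[of i "Suc n"] theta_strict_mono[of 1 i] theta_1 n_pos
  by (cases "i = 1") (auto simp: dep_def)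

text \<open>No departure lies strictly between the \<open>k\<close>-th and the next, so a traveler at time \<open>t\<close> has missed
exactly the routes up to \<open>k\<close> and waits for them until the next period.\<close>

lemma rmod_theta:
  assumes "k \<in> {1..n}" "j \<in> {1..n}" "t \<in> {dep k<..dep (Suc k)}"
  shows "(\<theta> j - t) rmod T = \<theta> j - t + (if j \<le> k then T else 0)"
proof -
  have t: "0 < t" "t \<le> T"
    using assms dep_strict_mono[of 1 k] dep_strict_mono[of "Suc k" "Suc n"] theta_1 n_pos
    by (cases "k = 1"; cases "k = n"; auto simp: dep_def split: if_splits)+
  show ?thesis
  proof (cases "j \<le> k")
    case True
    then have "\<theta> j < t" using assms theta_strict_mono[of j k] by (cases "j = k") (auto simp: dep_def)
    then show ?thesis using True t T_pos theta_range[OF assms(2)]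
      by (intro rmod_unique[where n = "-1"]) auto
  next
    case False
    then have "t \<le> \<theta> j" using assms theta_strict_mono[of "Suc k" j]
      by (cases "j = Suc k") (auto simp: dep_def)
    then show ?thesis using False t T_pos theta_range[OF assms(2)]
      by (intro rmod_unique[where n = 0]) auto
  qed
qed

lemma wait_eq:
  assumes "k \<in> {1..n}" "j \<in> {1..n}"
  shows "wait T \<theta> k j = \<theta> j - \<theta> k + (if j < k then T else 0)"
proof (cases "j < k")
  case True
  then show ?thesis
    using theta_strict_mono[of j k] theta_range[of j] theta_range[of k] assms T_pos
    unfolding wait_def by (auto intro!: rmod_unique[where n = "-1"])
next
  case False
  then have "\<theta> k \<le> \<theta> j" using theta_strict_mono[of k j] assms by (cases "j = k") auto
  then show ?thesis using False theta_range[of j] theta_range[of k] assms T_pos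
    unfolding wait_def by (auto intro!: rmod_unique[where n = 0])
qed

text \<open>Up to a factor common to all routes, route \<open>j\<close> has logit weight \<open>weight j\<close> before its departure, and
\<open>discount\<close> times that once it has departed and a further period has to be waited for.\<close>

definition weight :: "nat \<Rightarrow> real" where "weight j = exp (- \<beta> * (l j + \<theta> j))"

definition discount :: real where "discount = exp (- \<beta> * T)"

lemma discount_lt_1: "discount < 1" using beta_pos T_pos by (simp add: discount_def)

lemma exp_tau:
  assumes "j \<in> {1..n}"
  shows "exp (- \<beta> * \<tau> j) * (1 - exp (- \<beta> * y j)) = exp (- \<beta> * l j) * (1 - discount)"
proof -
  have p: "0 < 1 - exp (- \<beta> * y j)" "0 < 1 - discount" using y_pos[OF assms] beta_pos discount_lt_1 by simp_all
  have "- \<beta> * \<tau> j = - \<beta> * l j - ln ((1 - exp (- \<beta> * y j)) / (1 - discount))"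
    using beta_pos by (simp add: tau_hat_def discount_def algebra_simps)
  then have "exp (- \<beta> * \<tau> j) = exp (- \<beta> * l j) / ((1 - exp (- \<beta> * y j)) / (1 - discount))"
    using p by (simp only: exp_diff exp_ln divide_pos_pos)
  moreover have cancel: "e / (a / b) * a = e * b" if "0 < a" "0 < b" for a b e :: real
    using that by simp
  ultimately show ?thesis using p by (simp only: cancel)
qed

lemma weight_eq_diff:
  assumes "j \<in> {1..n}"
  shows "weight j * (1 - discount) = exp (- \<beta> * arr j) - exp (- \<beta> * arr (Suc j))"
proof -
  have "exp (- \<beta> * arr j) - exp (- \<beta> * arr (Suc j))
      = exp (- \<beta> * \<theta> j) * (exp (- \<beta> * \<tau> j) * (1 - exp (- \<beta> * y j)))"
    using assms arr_eq[OF assms] arr_Suc[of j]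
    by (simp add: algebra_simps flip: exp_add)
  then show ?thesis unfolding exp_tau[OF assms] weight_def
    by (simp add: algebra_simps flip: exp_add)
qed

text \<open>Without a missed route, \<open>1 - discount\<close> times the sum telescopes over the full cycle to
\<open>(1 - discount) * exp (- \<beta> * arr 1)\<close>, because the perceived arrival times advance by one period. Each further missed route
then lowers the sum by one of the differences in \<open>weight_eq_diff\<close>.\<close>

lemma sum_discounted_weights:
  "k \<le> n \<Longrightarrow> (\<Sum>j\<in>{1..n}. weight j * (if j \<le> k then discount else 1)) = exp (- \<beta> * arr (Suc k))"
proof (induction k)
  case 0
  have "(\<Sum>j\<in>{1..n}. weight j) * (1 - discount) = (\<Sum>j\<in>{1..n}. exp (- \<beta> * arr j) - exp (- \<beta> * arr (Suc j)))"
    using weight_eq_diff by (simp add: sum_distrib_right)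
  also have "\<dots> = exp (- \<beta> * arr 1) - exp (- \<beta> * arr (Suc n))"
    using sum_Suc_diff[of 1 n "\<lambda>j. - exp (- \<beta> * arr j)"] n_pos by simp
  also have "\<dots> = exp (- \<beta> * arr 1) * (1 - discount)"
    unfolding arr_Suc_n discount_def by (simp add: algebra_simps flip: exp_add)
  finally show ?case using discount_lt_1 by simp
next
  case (Suc k)
  have "(\<Sum>j\<in>{1..n}. weight j * (if j \<le> Suc k then discount else 1))
      = (\<Sum>j\<in>{1..n}. weight j * (if j \<le> k then discount else 1)
        - (if j = Suc k then weight j * (1 - discount) else 0))"
    by (rule sum.cong) (auto simp: algebra_simps)
  also have "\<dots> = exp (- \<beta> * arr (Suc k)) - weight (Suc k) * (1 - discount)"
    using Suc by (simp add: sum_subtractf)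
  also have "\<dots> = exp (- \<beta> * arr (Suc (Suc k)))"
    using weight_eq_diff[of "Suc k"] Suc by simp
  finally show ?case .
qed

text \<open>Used with \<open>P\<close> as the condition that route \<open>j\<close> has been missed, both for a traveler at an arbitrary
time \<open>t\<close> and for one who waits at the departure of a route.\<close>

lemma exp_observed:
  assumes "w = \<theta> j - t + (if P then T else 0)"
  shows "exp (- \<beta> * (l j + w)) = exp (\<beta> * t) * (weight j * (if P then discount else 1))"
  unfolding assms weight_def discount_def by (simp add: algebra_simps flip: exp_add)

lemma p_logit_eq:
  assumes "k \<in> {1..n}" "i \<in> {1..n}" "t \<in> {dep k<..dep (Suc k)}"
  shows "p_logit \<beta> n (observed_duration T l \<theta> t) i
    = weight i * (if i \<le> k then discount else 1) * exp (\<beta> * arr (Suc k))"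
proof -
  have e: "exp (- \<beta> * observed_duration T l \<theta> t j) = exp (\<beta> * t) * (weight j * (if j \<le> k then discount else 1))"
    if "j \<in> {1..n}" for j
    unfolding observed_duration_def using assms that by (intro exp_observed rmod_theta)
  have total: "(\<Sum>j\<in>{1..n}. exp (- \<beta> * observed_duration T l \<theta> t j))
      = exp (\<beta> * t) * exp (- \<beta> * arr (Suc k))"
    using e sum_discounted_weights[of k] assms by (simp add: sum_distrib_left[symmetric])
  then show ?thesis
    unfolding p_logit_def e[OF assms(2)] total by (simp add: exp_minus field_simps)
qed

text \<open>At the departure of route \<open>k\<close> the missed routes are those before \<open>k\<close>, hence the sum with \<open>k - 1\<close>
missed routes. For a single route the duration is \<open>l\<^sub>1\<close> by convention, and the estimate agrees with it
since the whole period is its headway.\<close>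

lemma char_tau_eq:
  assumes "k \<in> {1..n}"
  shows "char_tau T \<beta> n l \<theta> k = \<tau> k"
proof (cases "n = 1")
  case True
  then show ?thesis using assms sum_y discount_lt_1 by (simp add: char_tau_def tau_hat_def discount_def)
next
  case False
  have "(\<Sum>j\<in>{1..n}. exp (- \<beta> * (l j + wait T \<theta> k j)))
      = exp (\<beta> * \<theta> k) * (\<Sum>j\<in>{1..n}. weight j * (if j \<le> k - 1 then discount else 1))"
    unfolding sum_distrib_left
  proof (rule sum.cong)
    fix j assume "j \<in> {1..n}"
    moreover have "j < k \<longleftrightarrow> j \<le> k - 1" using assms by auto
    ultimately show "exp (- \<beta> * (l j + wait T \<theta> k j))
        = exp (\<beta> * \<theta> k) * (weight j * (if j \<le> k - 1 then discount else 1))"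
      using wait_eq[OF assms, of j] by (intro exp_observed) simp
  qed simp
  also have "(\<Sum>j\<in>{1..n}. weight j * (if j \<le> k - 1 then discount else 1)) = exp (- \<beta> * arr k)"
    using sum_discounted_weights[of "k - 1"] assms by auto
  also have "exp (\<beta> * \<theta> k) * \<dots> = exp (- \<beta> * \<tau> k)"
    unfolding arr_eq[OF assms] by (simp add: algebra_simps flip: exp_add)
  finally have "char_tau T \<beta> n l \<theta> k = - (1 / \<beta>) * ln (exp (- \<beta> * \<tau> k))"
    using False by (simp only: char_tau_def if_False)
  then show ?thesis using beta_pos by simp
qed

lemma departure_order_eq: "departure_order n \<theta> = [1..<Suc n]"
  unfolding departure_order_def
proof (rule sort_key_id_if_sorted)
  show "sorted (map \<theta> [1..<Suc n])"
    unfolding sorted_iff_nth_mono_less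
    using theta_strict_mono by (auto simp: less_imp_le simp del: upt_Suc)
qed

lemma departure_pos_eq: "i \<in> {1..n} \<Longrightarrow> departure_pos n \<theta> i = i - 1"
  unfolding departure_pos_def departure_order_eq
  by (rule the_equality) (auto simp del: upt_Suc)

lemma route_succ_eq: "i \<in> {1..n} \<Longrightarrow> route_succ n \<theta> i = (if i = n then 1 else Suc i)"
  unfolding route_succ_def
  by (auto simp: departure_pos_eq departure_order_eq simp del: upt_Suc)

lemma route_pred_eq: "i \<in> {1..n} \<Longrightarrow> route_pred n \<theta> i = (if i = 1 then n else i - 1)"
proof -
  assume i: "i \<in> {1..n}"
  have "(i - 1 + n - 1) mod n = (if i = 1 then n - 1 else i - 2)"
  proof (cases "i = 1")
    case False
    then have "i - 1 + n - 1 = (i - 2) + n" using i by auto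
    moreover have "i - 2 < n" using i by auto
    ultimately show ?thesis using False by (simp only: mod_add_self2 mod_less if_False)
  qed (use n_pos in simp)
  then show ?thesis using i n_pos unfolding route_pred_def
    by (auto simp: departure_pos_eq departure_order_eq simp del: upt_Suc)
qed

text \<open>With \<open>\<delta>\<close> the gap to the next departure and \<open>\<tau>\<close> as estimated, \<open>\<Delta>\<^sub>i\<close> is the difference of two
consecutive perceived arrival times.\<close>

lemma char_Delta_eq:
  assumes "i \<in> {1..n}"
  shows "char_Delta T \<beta> n l \<theta> i = y i"
proof -
  define s where "s = (if i = n then 1 else Suc i)"
  have s: "s \<in> {1..n}" "route_succ n \<theta> i = s"
    using assms n_pos route_succ_eq by (auto simp: s_def)
  have "char_delta T n \<theta> s = dep (Suc i) - \<theta> i"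
  proof (cases "n = 1")
    case True
    then show ?thesis unfolding dep_def using assms theta_1 by (simp add: char_delta_def)
  next
    case False
    then have "route_pred n \<theta> s = i"
      using route_pred_eq[OF s(1)] assms by (auto simp: s_def)
    then show ?thesis using False wait_eq[OF assms s(1)] assms theta_1
      by (auto simp: char_delta_def s_def dep_def)
  qed
  moreover have "dep (Suc i) + \<tau> s = arr (Suc i)"
    using arr_eq[of "Suc i"] arr_eq[of 1] arr_Suc_n theta_1 assms n_pos
    by (cases "i = n") (auto simp: dep_def s_def)
  ultimately show ?thesis
    unfolding char_Delta_def s(2) char_tau_eq[OF s(1)] char_tau_eq[OF assms]
    using arr_eq[OF assms] arr_Suc[of i] assms by simp
qed

text \<open>The left-hand side is \<open>T\<close> times the expected choice probability. Multiplied by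
\<open>exp (\<beta> arr (k + 1))\<close>, the gap becomes the increment of \<open>A k = cyc_stretch k * exp (\<beta> arr k)\<close>. The increments up to
route \<open>i\<close> count fully and the later ones are discounted; as \<open>A 1\<close> is the discounted \<open>A (n + 1)\<close>, only
\<open>(1 - discount) * A i\<close> remains.\<close>

lemma choice_sum_telescopes:
  assumes i: "i \<in> {1..n}"
  shows "(\<Sum>k\<in>{1..n}. (dep (Suc k) - dep k)
    * (weight i * (if i \<le> k then discount else 1) * exp (\<beta> * arr (Suc k)))) = y i"
proof -
  define A where "A k = cyc_stretch k * exp (\<beta> * arr k)" for k
  define c where "c k = (if i \<le> k then discount else 1)" for k
  have gap: "(dep (Suc k) - dep k) * exp (\<beta> * arr (Suc k)) = A (Suc k) - A k"
    if "k \<in> {1..n}" for k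
    unfolding dep_gap[OF that] A_def using arr_Suc[of k] that
    by (simp add: algebra_simps flip: exp_add)
  \<comment> \<open>A traveler one period later has the same prospects: \<open>cyc_stretch\<close> is cyclic and \<open>arr\<close> advances by \<open>T\<close>.\<close>
  have "A 1 = discount * A (Suc n)"
    using n_pos unfolding A_def discount_def arr_Suc_n by (simp add: cyc_stretch_def algebra_simps flip: exp_add)
  \<comment> \<open>Route \<open>i\<close> is missed from the gap \<open>k = i\<close> on, so the discount first enters in the increment from \<open>A i\<close>.\<close>
  have part: "(\<Sum>k\<in>{1..<m}. c k * (A (Suc k) - A k)) =
      (if m \<le> i then A m - A 1 else A i - A 1 + discount * (A m - A i))" if "m \<ge> 1" for m
    using that
  proof (induction rule: dec_induct)
    case (step m)
    show ?case
      using step by (cases "m < i"; cases "m = i") (auto simp: c_def algebra_simps)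
  qed (use i in auto)
  have "(\<Sum>k\<in>{1..n}. (dep (Suc k) - dep k) * (weight i * c k * exp (\<beta> * arr (Suc k))))
      = (\<Sum>k\<in>{1..n}. weight i * (c k * (A (Suc k) - A k)))"
    by (rule sum.cong) (simp_all flip: gap)
  also have "\<dots> = weight i * (A i - A 1 + discount * (A (Suc n) - A i))"
    using part[of "Suc n"] i by (simp add: atLeastLessThanSuc_atLeastAtMost sum_distrib_left[symmetric])
  also have "\<dots> = weight i * (1 - discount) * A i"
    using \<open>A 1 = discount * A (Suc n)\<close> by (simp add: algebra_simps)
  also have "\<dots> = (1 - exp (- \<beta> * y i)) * cyc_stretch i"
    unfolding weight_eq_diff[OF i] A_def using arr_Suc[of i] i
    by (simp add: algebra_simps flip: exp_add)
  also have "\<dots> = y i"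
    using i y_pos[OF i] beta_pos by (simp add: cyc_stretch_def stretch_def)
  finally show ?thesis unfolding c_def .
qed

lemma p_logit_measurable: "(\<lambda>t. p_logit \<beta> n (observed_duration T l \<theta> t) i) \<in> borel_measurable borel"
  unfolding p_logit_def observed_duration_def rmod_def by measurable

lemma expected_choice_probability:
  assumes i: "i \<in> {1..n}"
  shows "(\<integral>t. p_logit \<beta> n (observed_duration T l \<theta> t) i \<partial>uniform_measure lborel {0..<T})
    = char_Delta T \<beta> n l \<theta> i / T"
proof -
  have "has_bochner_integral lborel
      (\<lambda>t. indicator {dep 1<..dep (Suc n)} t * p_logit \<beta> n (observed_duration T l \<theta> t) i)
      (\<Sum>k\<in>{1..<Suc n}. (dep (Suc k) - dep k)
        * (weight i * (if i \<le> k then discount else 1) * exp (\<beta> * arr (Suc k))))"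
    by (intro has_bochner_integral_step_function[THEN conjunct2])
      (use dep_less_Suc p_logit_eq i in \<open>auto simp: less_imp_le\<close>)
  moreover have "dep 1 = 0" "dep (Suc n) = T" using n_pos theta_1 by (simp_all add: dep_def)
  ultimately have "(\<integral>t. indicator {0<..T} t * p_logit \<beta> n (observed_duration T l \<theta> t) i \<partial>lborel) = y i"
    using choice_sum_telescopes[OF i]
    by (simp add: has_bochner_integral_integral_eq atLeastLessThanSuc_atLeastAtMost)
  then show ?thesis
    using integral_uniform_measure_interval[OF p_logit_measurable T_pos] char_Delta_eq[OF i] by simp
qed

end

lemma time_table_logit_stationary:
  assumes "T > 0" "\<beta> > 0" "n \<ge> 1" "time_table_logit T \<beta> n l \<theta>"
  obtains y \<mu> where "stationary_timetable T \<beta> n l \<theta> y \<mu>"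
proof -
  obtain y where min: "is_arg_min (logit_cost T \<beta> n l) (feasible_headways T n) y"
    and theta: "\<theta> 1 = 0" "\<And>i. i \<in> {2..n} \<Longrightarrow> \<theta> i = \<theta> (i - 1) + delta_hat T \<beta> l y i"
    using assms(4) by (auto simp: time_table_logit_def)
  have "stationary_timetable T \<beta> n l \<theta> y (tau_hat T \<beta> l y 1 + stretch \<beta> (y 1))"
  proof
    show "tau_hat T \<beta> l y i + stretch \<beta> (y i) = tau_hat T \<beta> l y 1 + stretch \<beta> (y 1)"
      if "i \<in> {1..n}" for i
      using that assms(3) by (intro optimal_headways_stationary[OF min assms(1,2)]) auto
    show "(\<Sum>i\<in>{1..n}. y i) = T"
      using min by (simp add: is_arg_min_def feasible_headways_def)
  qed (use assms theta optimal_headways_pos[OF min assms(1,2)] in blast)+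
  then show thesis by (rule that)
qed

theorem proposition21:
  fixes n :: nat and l \<theta> :: "nat \<Rightarrow> real" and T \<beta> :: real
  assumes "T > 0" and "\<beta> > 0"
    and "time_table_logit T \<beta> n l \<theta>"
  shows "(\<forall>i\<in>{1..n}. \<theta> i \<in> {0..<T}) \<and>
    (\<forall>i\<in>{1..n}.
      (\<integral>t. p_logit \<beta> n (observed_duration T l \<theta> t) i \<partial>uniform_measure lborel {0..<T})
        = char_Delta T \<beta> n l \<theta> i / T)"
proof (cases "n \<ge> 1")
  case True
  then obtain y \<mu> where "stationary_timetable T \<beta> n l \<theta> y \<mu>"
    using time_table_logit_stationary assms by blast
  then interpret stationary_timetable T \<beta> n l \<theta> y \<mu> .
  show ?thesis using theta_range expected_choice_probability by blast
qed simp

end
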